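(* Let $(\xi_k)_{k\ge 1}$ be an i.i.d. sequence of random variables with values in $[0,1]$ and continuous distribution function $F(t)=\mathsf{P}(\xi_1\le t)$, and let $F_n(t)=\frac1n\sum_{k=1}^n I_{\{\xi_k\le t\}}$. There exists $T_0\in(0,1)$ such that for every $T\in(T_0,1)$, every $\alpha\in\big(0,\frac12\big)$ and every $\varepsilon>0$, $$ \lim_{n\to\infty}\frac{1}{n^{1-2\alpha}}\log\mathsf{P}\Big(\sup_{t\in[0,T]}n^\alpha|F_n(t)-F(t)|\ge\varepsilon\Big)=-2\varepsilon^2 . $$
   Context: $I_{A}$ denotes the indicator of the event $A$, and $\log$ is the natural logarithm. *)

theory Defs
  imports "HOL-Probability.Probability"
begin

text \<open>The sample is indexed from 1. At \<open>n = 0\<close> the value is 0, since division by zero is 0.\<close>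

definition ecdf :: "(nat \<Rightarrow> 'a \<Rightarrow> real) \<Rightarrow> nat \<Rightarrow> 'a \<Rightarrow> real \<Rightarrow> real" where
  "ecdf \<xi> n \<omega> t = 1 / real n * (\<Sum>k=1..n. indicator {\<omega>'. \<xi> k \<omega>' \<le> t} \<omega>)"

end

theory Submission
  imports Defs "HOL-Real_Asymp.Real_Asymp"
begin

text \<open>
  The rate \<open>2 \<epsilon>\<^sup>2\<close> is the exponent of the worst single coordinate: the empirical distribution
  function at a point \<open>t\<close> is the mean of \<open>n\<close> independent Bernoulli variables with success
  probability \<open>F t\<close>, the variance \<open>F t (1 - F t)\<close> is largest, equal to \<open>1/4\<close>, at a median of \<open>F\<close>,
  and there a deviation \<open>\<epsilon> n powr (-\<alpha>)\<close> costs about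
  \<open>n (\<epsilon> n powr (-\<alpha>))\<^sup>2 / (2 \<cdot> 1/4) = 2 \<epsilon>\<^sup>2 n powr (1 - 2 \<alpha>)\<close> in the exponent. Since \<open>F\<close> is continuous
  and the sample lies in \<open>[0,1]\<close>, a median \<open>m\<close> exists with \<open>0 \<le> m < 1\<close>. Any threshold in
  \<open>(0,1)\<close> that is at least \<open>m\<close> serves as \<open>T0\<close>; the midpoint of \<open>m\<close> and 1 is one even if \<open>m = 0\<close>.
  The argument matches a lower and an upper bound, both valid at fixed \<open>n\<close>.

  Lower bound (\<open>prob_Sup_deviation_ge\<close>). The supremum is at least the deviation at the median,
  where the number of sample points not exceeding \<open>m\<close> is binomial with parameter \<open>1/2\<close>. A single
  value \<open>k\<close> of that number already has probability at least \<open>exp (- n D(k/n)) / (n + 1)\<close>, with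
  \<open>D\<close> the relative entropy to a fair coin (\<open>binomial_fair_ge_exp_KL\<close>). Choosing \<open>k\<close> just above
  \<open>n/2 + \<epsilon> n powr (1 - \<alpha>)\<close> and using \<open>D(1/2 + d) = 2 d\<^sup>2 + o(d\<^sup>2)\<close> gives the rate.

  Upper bound (\<open>prob_Sup_deviation_le\<close>). By monotonicity of both distribution functions, the
  supremum differs by at most \<open>1/n\<close> from the maximum over a grid of \<open>n + 1\<close> quantiles, which exist
  because \<open>F\<close> is continuous. Hoeffding's inequality bounds each grid point with the variance proxy
  \<open>1/4\<close>, and the union bound costs a factor \<open>n + 1\<close>.

  The polynomial factors and the error \<open>1/n\<close> are invisible at the scale \<open>n powr (1 - 2 \<alpha>)\<close>, because
  \<open>0 < \<alpha> < 1/2\<close> makes that scale dominate \<open>ln n\<close> and makes \<open>n powr (-\<alpha>)\<close> dominate \<open>1/n\<close>.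
\<close>

section \<open>A relative entropy bound for binomial coefficients\<close>

text \<open>The sequence \<open>k ^ j / j!\<close> in \<open>j\<close> increases up to \<open>j = k\<close> and decreases from there, its
  consecutive ratio being \<open>k / (j + 1)\<close>. The inequality is cleared of denominators.\<close>

lemma power_div_fact_max_at_base:
  fixes j k :: nat
  shows "fact k * k ^ j \<le> (fact j * k ^ k :: nat)"
proof (cases "j \<le> k")
  case True
  then show ?thesis
  proof (induction j rule: inc_induct)
    case base
    show ?case by simp
  next
    case (step m)
    have "k * (fact k * k ^ m) = fact k * k ^ Suc m" by simp
    also have "\<dots> \<le> fact (Suc m) * k ^ k" by (rule step.IH)
    also have "\<dots> = Suc m * (fact m * k ^ k)" by (simp add: algebra_simps)
    also have "\<dots> \<le> k * (fact m * k ^ k)" using step.hyps by (intro mult_right_mono) auto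
    finally show ?case using step.hyps by simp
  qed
next
  case False
  then have "k \<le> j" by simp
  then show ?thesis
  proof (induction j rule: dec_induct)
    case base
    show ?case by simp
  next
    case (step m)
    have "fact k * k ^ Suc m = k * (fact k * k ^ m)" by simp
    also have "\<dots> \<le> Suc m * (fact m * k ^ k)" using step.hyps by (intro mult_mono step.IH) auto
    also have "\<dots> = fact (Suc m) * k ^ k" by (simp add: algebra_simps)
    finally show ?case .
  qed
qed

text \<open>In the binomial expansion of \<open>(k + (n - k)) ^ n\<close> the term of index \<open>k\<close> is the largest: the
  binomial distribution with parameter \<open>k/n\<close> has its mode at \<open>k\<close>. So this one of the \<open>n + 1\<close> terms
  carries at least the fraction \<open>1 / (n + 1)\<close> of the total \<open>n ^ n\<close>.\<close>

lemma binomial_ge_entropy_bound: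
  fixes k n :: nat
  assumes "k \<le> n"
  shows "n ^ n \<le> (n + 1) * ((n choose k) * k ^ k * (n - k) ^ (n - k))"
proof -
  have mode: "(n choose j) * k ^ j * (n - k) ^ (n - j) \<le> (n choose k) * k ^ k * (n - k) ^ (n - k)"
    if "j \<le> n" for j
  proof -
    let ?D = "fact k * fact (n - k) * (fact j * fact (n - j)) :: nat"
    have "?D * ((n choose j) * k ^ j * (n - k) ^ (n - j))
        = (fact j * fact (n - j) * (n choose j)) * (fact k * k ^ j) * (fact (n - k) * (n - k) ^ (n - j))"
      by (simp only: ac_simps)
    also have "\<dots> = fact n * (fact k * k ^ j) * (fact (n - k) * (n - k) ^ (n - j))"
      by (simp only: binomial_fact_lemma[OF that])
    also have "\<dots> \<le> fact n * (fact j * k ^ k) * (fact (n - j) * (n - k) ^ (n - k))"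
      by (intro mult_mono power_div_fact_max_at_base) auto
    also have "\<dots> = (fact k * fact (n - k) * (n choose k)) * (fact j * k ^ k) * (fact (n - j) * (n - k) ^ (n - k))"
      by (simp only: binomial_fact_lemma[OF assms])
    also have "\<dots> = ?D * ((n choose k) * k ^ k * (n - k) ^ (n - k))"
      by (simp only: ac_simps)
    finally show ?thesis
      by (rule mult_left_le_imp_le) simp
  qed
  have "n ^ n = (k + (n - k)) ^ n" using assms by simp
  also have "\<dots> = (\<Sum>j\<le>n. (n choose j) * k ^ j * (n - k) ^ (n - j))"
    by (subst binomial) simp
  also have "\<dots> \<le> (\<Sum>j\<le>n. (n choose k) * k ^ k * (n - k) ^ (n - k))"
    by (intro sum_mono mode) auto
  finally show ?thesis by simp
qed

text \<open>Relative entropy of the Bernoulli distribution with parameter \<open>1/2 + d\<close> with respect to that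
  with parameter \<open>1/2\<close>. The displacement \<open>d\<close> from the centre is the argument because only its behaviour
  near \<open>0\<close> matters.\<close>

definition fair_coin_KL :: "real \<Rightarrow> real" where
  "fair_coin_KL d = (1/2 + d) * ln (1 + 2 * d) + (1/2 - d) * ln (1 - 2 * d)"

lemma fair_coin_KL_asymp: "((\<lambda>d. fair_coin_KL d / d\<^sup>2) \<longlongrightarrow> 2) (at_right 0)"
  unfolding fair_coin_KL_def by real_asymp

lemma binomial_fair_ge_exp_KL:
  assumes "0 < k" "k < n"
  shows "exp (- real n * fair_coin_KL (real k / real n - 1/2)) / real (n + 1) \<le> real (n choose k) / 2 ^ n"
proof -
  let ?m = "n - k"
  have pos: "real n > 0" "real k > 0" "real ?m > 0" using assms by auto
  have m: "real ?m = real n - real k" using assms by simp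
  have a: "1 + 2 * (real k / real n - 1/2) = 2 * real k / real n"
    "1 - 2 * (real k / real n - 1/2) = 2 * real ?m / real n"
    "real n * (1/2 + (real k / real n - 1/2)) = real k"
    "real n * (1/2 - (real k / real n - 1/2)) = real ?m"
    using pos unfolding m by (simp_all add: field_simps)
  have "real n * fair_coin_KL (real k / real n - 1/2)
      = real k * ln (2 * real k / real n) + real ?m * ln (2 * real ?m / real n)"
    unfolding fair_coin_KL_def a(1,2) distrib_left[of "real n" "_ * ln _"]
      mult.assoc[of "real n", symmetric] a(3,4) ..
  also have "exp \<dots> = (2 * real k / real n) ^ k * (2 * real ?m / real n) ^ ?m"
    using pos by (simp add: exp_add exp_of_nat_mult del: of_nat_diff)
  also have "\<dots> = 2 ^ (k + ?m) * (real k ^ k * real ?m ^ ?m) / real n ^ (k + ?m)"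
    by (simp add: power_mult_distrib power_divide power_add)
  finally have E: "exp (real n * fair_coin_KL (real k / real n - 1/2)) =
      2 ^ n * (real k ^ k * real ?m ^ ?m) / real n ^ n"
    using assms by simp
  have "real (n ^ n) \<le> real ((n + 1) * ((n choose k) * k ^ k * ?m ^ ?m))"
    using binomial_ge_entropy_bound[of k n] assms by (intro of_nat_mono) auto
  then have "real n ^ n \<le> real (n + 1) * real (n choose k) * (real k ^ k * real ?m ^ ?m)"
    by (simp only: of_nat_mult of_nat_power mult.assoc)
  moreover have "real k ^ k * real ?m ^ ?m > 0" using pos by simp
  ultimately have "real n ^ n / (real k ^ k * real ?m ^ ?m) \<le> real (n + 1) * real (n choose k)"
    by (subst pos_divide_le_eq) auto
  then have "(real n ^ n / (real k ^ k * real ?m ^ ?m)) / (2 ^ n * real (n + 1))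
      \<le> (real (n + 1) * real (n choose k)) / (2 ^ n * real (n + 1))"
    by (intro divide_right_mono) auto
  moreover have "exp (- real n * fair_coin_KL (real k / real n - 1/2)) / real (n + 1)
      = (real n ^ n / (real k ^ k * real ?m ^ ?m)) / (2 ^ n * real (n + 1))"
    unfolding mult_minus_left exp_minus E by (simp add: ac_simps del: of_nat_diff of_nat_Suc of_nat_add)
  ultimately show ?thesis by simp
qed

section \<open>Reducing a supremum of deviations to a finite grid\<close>

lemma grid_bracket:
  fixes q :: "nat \<Rightarrow> real"
  assumes "0 < K" "q 0 \<le> t" "t \<le> q K"
  shows "\<exists>j<K. q j \<le> t \<and> t \<le> q (Suc j)"
  using assms
proof (induction K rule: nat_induct_non_zero)
  case 1
  then show ?case by auto
next
  case (Suc K)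
  then show ?case by (metis less_Suc_eq linear)
qed

text \<open>The points need not be increasing: having \<open>a\<close> and \<open>b\<close> as first and last point is enough for every
  \<open>t \<in> {a..b}\<close> to lie between two consecutive grid points.\<close>

definition fine_grid :: "(real \<Rightarrow> real) \<Rightarrow> real \<Rightarrow> real \<Rightarrow> nat \<Rightarrow> (nat \<Rightarrow> real) \<Rightarrow> bool" where
  "fine_grid F a b K q \<longleftrightarrow> q 0 = a \<and> q K = b \<and> (\<forall>j\<le>K. q j \<in> {a..b}) \<and>
     (\<forall>j<K. F (q (Suc j)) - F (q j) \<le> 1 / real K)"

text \<open>The intermediate value theorem supplies points at which \<open>F\<close> takes equally spaced values. The
  number of steps needed for mesh \<open>1/K\<close> in the values of \<open>F\<close> is thus \<open>K\<close>, whatever the modulus of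
  continuity of \<open>F\<close>; the union bound depends on this.\<close>

lemma quantile_grid_exists:
  fixes F :: "real \<Rightarrow> real"
  assumes cont: "continuous_on {a..b} F" and "a \<le> b" and le: "F a \<le> F b" "F b - F a \<le> 1" and "0 < K"
  shows "\<exists>q. fine_grid F a b K q"
proof -
  define y where "y j = F a + real j / real K * (F b - F a)" for j :: nat
  have y: "F a \<le> y j" "y j \<le> F b" if "j \<le> K" for j
  proof -
    have "real j / real K * (F b - F a) \<le> 1 * (F b - F a)"
      using that le \<open>0 < K\<close> by (intro mult_right_mono) auto
    then show "y j \<le> F b" by (simp add: y_def)
    show "F a \<le> y j" using le by (simp add: y_def)
  qed
  have "\<exists>x\<in>{a..b}. F x = y j \<and> (j = 0 \<longrightarrow> x = a) \<and> (j = K \<longrightarrow> x = b)" if j: "j \<le> K" for j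
  proof -
    have ends: "y 0 = F a" "y K = F b" using \<open>0 < K\<close> by (simp_all add: y_def)
    consider "j = 0" | "j = K" | "j \<noteq> 0" "j \<noteq> K" by blast
    then show ?thesis
    proof cases
      case 1
      then show ?thesis using ends \<open>0 < K\<close> \<open>a \<le> b\<close> by (intro bexI[of _ a]) auto
    next
      case 2
      then show ?thesis using ends \<open>0 < K\<close> \<open>a \<le> b\<close> by (intro bexI[of _ b]) auto
    next
      case 3
      obtain x where "a \<le> x" "x \<le> b" "F x = y j"
        using IVT'[OF y(1)[OF j] y(2)[OF j] \<open>a \<le> b\<close> cont] by blast
      with 3 show ?thesis by auto
    qed
  qed
  then obtain q where q: "\<And>j. j \<le> K \<Longrightarrow>
      q j \<in> {a..b} \<and> F (q j) = y j \<and> (j = 0 \<longrightarrow> q j = a) \<and> (j = K \<longrightarrow> q j = b)"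
    by metis
  have "F (q (Suc j)) - F (q j) \<le> 1 / real K" if "j < K" for j
  proof -
    have "F (q (Suc j)) - F (q j) = (F b - F a) / real K"
      using q[of j] q[of "Suc j"] that by (simp add: y_def field_simps)
    also have "\<dots> \<le> 1 / real K" using le by (intro divide_right_mono) auto
    finally show ?thesis .
  qed
  then have "fine_grid F a b K q" using q[of 0] q[of K] q by (auto simp: fine_grid_def)
  then show ?thesis by blast
qed

text \<open>If \<open>q j \<le> t \<le> q (j + 1)\<close>, an excess of \<open>G\<close> over \<open>F\<close> at \<open>t\<close> persists at the right
  neighbour and a deficit persists at the left one, up to the increment of \<open>F\<close> on the cell.\<close>

lemma deviation_le_grid_deviation:
  fixes F G :: "real \<Rightarrow> real"
  assumes "mono F" "mono G" and q: "fine_grid F a b K q" and "0 < K" and t: "t \<in> {a..b}"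
  shows "\<exists>j\<le>K. \<bar>G t - F t\<bar> \<le> \<bar>G (q j) - F (q j)\<bar> + 1 / real K"
proof -
  obtain j where j: "j < K" "q j \<le> t" "t \<le> q (Suc j)"
    using grid_bracket[of K q t] assms by (auto simp: fine_grid_def)
  have mono: "F (q j) \<le> F t" "F t \<le> F (q (Suc j))" "G (q j) \<le> G t" "G t \<le> G (q (Suc j))"
    using j assms by (auto dest: monoD)
  have inc: "F (q (Suc j)) - F (q j) \<le> 1 / real K" using q j by (auto simp: fine_grid_def)
  show ?thesis
  proof (cases "G t \<ge> F t")
    case True
    then show ?thesis using mono inc j by (intro exI[of _ "Suc j"]) linarith
  next
    case False
    then show ?thesis using mono inc j by (intro exI[of _ j]) linarith
  qed
qed

lemma bdd_above_deviation:
  fixes F G :: "real \<Rightarrow> real"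
  assumes "mono F" "mono G" "0 \<le> c"
  shows "bdd_above ((\<lambda>t. c * \<bar>G t - F t\<bar>) ` {a..b})"
proof (rule bdd_aboveI2)
  fix t assume "t \<in> {a..b}"
  then have "F a \<le> F t" "F t \<le> F b" "G a \<le> G t" "G t \<le> G b"
    using assms by (auto dest: monoD)
  then show "c * \<bar>G t - F t\<bar> \<le> c * (\<bar>G b - F a\<bar> + \<bar>F b - G a\<bar>)"
    using \<open>0 \<le> c\<close> by (intro mult_left_mono) linarith+
qed

text \<open>The grid maxima approximate the supremum from below with error \<open>c / K\<close>, for every \<open>K\<close>. This
  describes the event that the supremum reaches \<open>\<epsilon>\<close> by countably many grid points, which shows that it is
  measurable, and the instance \<open>K = n\<close> of the right-hand side is the reduction for the upper bound.\<close>

lemma Sup_deviation_ge_iff: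
  fixes F G :: "real \<Rightarrow> real"
  assumes "mono F" "mono G" "a \<le> b" "0 \<le> c"
    and q: "\<And>K. 0 < K \<Longrightarrow> fine_grid F a b K (q K)"
  shows "\<epsilon> \<le> (SUP t\<in>{a..b}. c * \<bar>G t - F t\<bar>) \<longleftrightarrow>
         (\<forall>K>0. \<exists>j\<le>K. \<epsilon> - c / real K \<le> c * \<bar>G (q K j) - F (q K j)\<bar>)"
    (is "\<epsilon> \<le> ?S \<longleftrightarrow> ?R")
proof -
  have dev: "\<exists>j\<le>K. c * \<bar>G t - F t\<bar> \<le> c * \<bar>G (q K j) - F (q K j)\<bar> + c / real K"
    if K: "0 < K" and t: "t \<in> {a..b}" for t K
  proof -
    obtain j where "j \<le> K" "\<bar>G t - F t\<bar> \<le> \<bar>G (q K j) - F (q K j)\<bar> + 1 / real K"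
      using deviation_le_grid_deviation[OF assms(1,2) q[OF K] K t] by blast
    then show ?thesis
      using mult_left_mono[OF _ \<open>0 \<le> c\<close>, of "\<bar>G t - F t\<bar>" "\<bar>G (q K j) - F (q K j)\<bar> + 1 / real K"]
      by (auto simp: distrib_left)
  qed
  note bdd = bdd_above_deviation[OF assms(1,2,4), of a b]
  show ?thesis
  proof
    assume S: "\<epsilon> \<le> ?S"
    show ?R
    proof (intro allI impI)
      fix K :: nat assume "0 < K"
      define m where "m = Max ((\<lambda>j. c * \<bar>G (q K j) - F (q K j)\<bar>) ` {..K})"
      have "?S \<le> m + c / real K"
      proof (rule cSUP_least)
        show "{a..b} \<noteq> {}" using \<open>a \<le> b\<close> by auto
        fix t assume "t \<in> {a..b}"
        from dev[OF \<open>0 < K\<close> this] obtain j where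
          "j \<le> K" "c * \<bar>G t - F t\<bar> \<le> c * \<bar>G (q K j) - F (q K j)\<bar> + c / real K" by blast
        moreover from \<open>j \<le> K\<close> have "c * \<bar>G (q K j) - F (q K j)\<bar> \<le> m"
          unfolding m_def by (intro Max_ge) auto
        ultimately show "c * \<bar>G t - F t\<bar> \<le> m + c / real K" by linarith
      qed
      moreover have "m \<in> (\<lambda>j. c * \<bar>G (q K j) - F (q K j)\<bar>) ` {..K}"
        unfolding m_def by (intro Max_in) auto
      ultimately show "\<exists>j\<le>K. \<epsilon> - c / real K \<le> c * \<bar>G (q K j) - F (q K j)\<bar>"
        using S by force
    qed
  next
    assume R: ?R
    have "\<epsilon> - c / real K \<le> ?S" if "0 < K" for K
    proof -
      obtain j where j: "j \<le> K" "\<epsilon> - c / real K \<le> c * \<bar>G (q K j) - F (q K j)\<bar>"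
        using R \<open>0 < K\<close> by blast
      moreover have "q K j \<in> {a..b}" using q[OF \<open>0 < K\<close>] j by (auto simp: fine_grid_def)
      then have "c * \<bar>G (q K j) - F (q K j)\<bar> \<le> ?S" by (intro cSUP_upper bdd)
      ultimately show ?thesis by linarith
    qed
    moreover have "(\<lambda>K. \<epsilon> - c / real K) \<longlonglongrightarrow> \<epsilon>" by real_asymp
    ultimately show "\<epsilon> \<le> ?S"
      by (intro LIMSEQ_le_const2) (auto intro!: exI[of _ 1])
  qed
qed

section \<open>Counting successes and the empirical distribution function\<close>

text \<open>The event splits according to the set \<open>S\<close> of indices of the successes. There are as many
  sets \<open>S\<close> as the binomial coefficient says, and by independence all of them are equally likely.\<close>

lemma (in prob_space) prob_card_hits_eq_binomial:
  assumes indep: "indep_vars N X I" and I: "finite I" "I \<noteq> {}"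
    and B: "\<And>i. i \<in> I \<Longrightarrow> B i \<in> sets (N i)"
    and p: "\<And>i. i \<in> I \<Longrightarrow> prob (X i -` B i \<inter> space M) = p"
  shows "prob {\<omega> \<in> space M. card {i \<in> I. X i \<omega> \<in> B i} = k}
           = real (card I choose k) * p ^ k * (1 - p) ^ (card I - k)"
proof -
  have X: "X i \<in> measurable M (N i)" if "i \<in> I" for i
    using indep that unfolding indep_vars_def2 by blast
  define A where "A S = (\<Inter>i\<in>I. X i -` (if i \<in> S then B i else space (N i) - B i) \<inter> space M)" for S
  have A_iff: "\<omega> \<in> A S \<longleftrightarrow> \<omega> \<in> space M \<and> {i \<in> I. X i \<omega> \<in> B i} = S" if "S \<subseteq> I" for \<omega> S
    using that I measurable_space[OF X] unfolding A_def by (auto split: if_splits)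
  have A_sets: "A S \<in> events" for S
    unfolding A_def using I B X by (intro sets.finite_INT measurable_sets) auto
  have A_prob: "prob (A S) = p ^ card S * (1 - p) ^ (card I - card S)" if "S \<subseteq> I" for S
  proof -
    have compl: "prob (X i -` (space (N i) - B i) \<inter> space M) = 1 - p" if "i \<in> I" for i
    proof -
      have "X i -` (space (N i) - B i) \<inter> space M = space M - (X i -` B i \<inter> space M)"
        using measurable_space[OF X[OF that]] by auto
      then show ?thesis
        using prob_compl[OF measurable_sets[OF X[OF that] B[OF that]]] p[OF that] by simp
    qed
    have "prob (A S) = (\<Prod>i\<in>I. prob (X i -` (if i \<in> S then B i else space (N i) - B i) \<inter> space M))"
      unfolding A_def using I B by (intro indep_varsD_finite[OF indep]) auto
    also have "\<dots> = (\<Prod>i\<in>I. if i \<in> S then p else 1 - p)"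
      by (intro prod.cong) (auto simp: p compl)
    also have "\<dots> = (\<Prod>i\<in>I \<inter> S. p) * (\<Prod>i\<in>I \<inter> - S. 1 - p)"
      using I by (subst prod.If_cases) (simp_all add: Int_def)
    also have "\<dots> = p ^ card S * (1 - p) ^ (card I - card S)"
      using that I card_Diff_subset[of S I]
      by (simp add: Int_absorb1 Diff_eq[symmetric] finite_subset[OF that])
    finally show ?thesis .
  qed
  let ?F = "{S. S \<subseteq> I \<and> card S = k}"
  have fin: "finite ?F" using I by auto
  have "{\<omega> \<in> space M. card {i \<in> I. X i \<omega> \<in> B i} = k} = (\<Union>S\<in>?F. A S)"
    using A_iff by auto
  also have "prob \<dots> = (\<Sum>S\<in>?F. prob (A S))"
  proof (rule finite_measure_finite_Union[OF fin])
    show "A ` ?F \<subseteq> events" using A_sets by auto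
    show "disjoint_family_on A ?F"
    unfolding disjoint_family_on_def
    proof (intro ballI impI)
      fix S T assume "S \<in> ?F" "T \<in> ?F" "S \<noteq> T"
      then show "A S \<inter> A T = {}" using A_iff[of S] A_iff[of T] by blast
    qed
  qed
  also have "\<dots> = (\<Sum>S\<in>?F. p ^ k * (1 - p) ^ (card I - k))"
    by (intro sum.cong) (auto simp: A_prob)
  also have "\<dots> = real (card I choose k) * p ^ k * (1 - p) ^ (card I - k)"
    using n_subsets[OF I(1)] by simp
  finally show ?thesis .
qed

lemma ecdf_eq_sum_indicator:
  "ecdf \<xi> n \<omega> t = (\<Sum>k=1..n. indicator {..t} (\<xi> k \<omega>)) / real n"
  by (simp add: ecdf_def indicator_def)

lemma ecdf_eq_card: "ecdf \<xi> n \<omega> t = real (card {k \<in> {1..n}. \<xi> k \<omega> \<in> {..t}}) / real n"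
proof -
  have "(\<Sum>k=1..n. indicator {..t} (\<xi> k \<omega>) :: real) = (\<Sum>k | k \<in> {1..n} \<and> \<xi> k \<omega> \<in> {..t}. 1)"
  proof (rule sum.mono_neutral_cong_right)
  qed (simp_all add: indicator_def subset_iff)
  also have "\<dots> = real (card {k \<in> {1..n}. \<xi> k \<omega> \<in> {..t}})"
    by (rule real_of_card[symmetric])
  finally show ?thesis by (simp only: ecdf_eq_sum_indicator)
qed

lemma mono_ecdf: "mono (ecdf \<xi> n \<omega>)"
  unfolding ecdf_eq_sum_indicator
  by (intro monoI divide_right_mono sum_mono) (auto simp: indicator_def)

locale continuous_iid_sample = prob_space M for M :: "'a measure" +
  fixes \<xi> :: "nat \<Rightarrow> 'a \<Rightarrow> real" and F :: "real \<Rightarrow> real"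
  assumes indep: "indep_vars (\<lambda>_. borel) \<xi> {1..}"
    and ident: "\<And>k. k \<ge> 1 \<Longrightarrow> distr M borel (\<xi> k) = distr M borel (\<xi> 1)"
    and F: "\<And>t. F t = prob {\<omega> \<in> space M. \<xi> 1 \<omega> \<le> t}"
    and cont: "continuous_on UNIV F"
begin

lemma sample_measurable: "k \<ge> 1 \<Longrightarrow> \<xi> k \<in> borel_measurable M"
  using indep by (auto simp: indep_vars_def2)

lemma F_bounds: "0 \<le> F t" "F t \<le> 1"
  by (simp_all add: F)

lemma mono_F: "mono F"
proof (rule monoI)
  have [measurable]: "\<xi> (Suc 0) \<in> borel_measurable M" by (rule sample_measurable) simp
  fix s t :: real assume "s \<le> t"
  then show "F s \<le> F t" unfolding F by (intro finite_measure_mono) auto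
qed

lemma prob_sample_le:
  assumes "k \<ge> 1"
  shows "prob (\<xi> k -` {..t} \<inter> space M) = F t"
proof -
  have "prob (\<xi> k -` {..t} \<inter> space M) = measure (distr M borel (\<xi> k)) {..t}"
    by (rule measure_distr[symmetric]) (auto intro: sample_measurable assms)
  also have "\<dots> = measure (distr M borel (\<xi> 1)) {..t}"
    by (simp only: ident[OF assms])
  also have "\<dots> = prob (\<xi> 1 -` {..t} \<inter> space M)"
    by (rule measure_distr) (auto intro: sample_measurable)
  also have "\<xi> 1 -` {..t} \<inter> space M = {\<omega> \<in> space M. \<xi> 1 \<omega> \<le> t}" by auto
  finally show ?thesis by (simp only: F)
qed

lemma ecdf_measurable: "(\<lambda>\<omega>. ecdf \<xi> n \<omega> t) \<in> borel_measurable M"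
  unfolding ecdf_eq_sum_indicator
  by (intro borel_measurable_divide borel_measurable_sum borel_measurable_const
      measurable_compose[OF sample_measurable] borel_measurable_indicator) auto

lemma ecdf_deviation_le:
  assumes "n > 0" "\<delta> \<ge> 0"
  shows "prob {\<omega> \<in> space M. \<delta> \<le> \<bar>ecdf \<xi> n \<omega> t - F t\<bar>} \<le> 2 * exp (- 2 * real n * \<delta>\<^sup>2)"
proof -
  note rv = sample_measurable
  have rv1: "\<xi> 1 \<in> borel_measurable M" by (rule rv) simp
  let ?h = "indicator {..t} :: real \<Rightarrow> real"
  interpret H: Hoeffding_ineq_iid M "{1..n}" "\<lambda>k \<omega>. ?h (\<xi> k \<omega>)" "\<lambda>\<omega>. ?h (\<xi> 1 \<omega>)" 0 1
    "expectation (\<lambda>\<omega>. ?h (\<xi> 1 \<omega>))"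
  proof unfold_locales
    show "indep_vars (\<lambda>_. borel) (\<lambda>k \<omega>. ?h (\<xi> k \<omega>)) {1..n}"
      by (intro indep_vars_compose2[OF indep_vars_subset[OF indep]]) auto
    fix i assume i: "i \<in> {1..n}"
    have h: "?h \<in> borel_measurable borel" by simp
    have "\<xi> i \<in> borel_measurable M" using i by (intro rv) auto
    then have "distr M borel (\<lambda>\<omega>. ?h (\<xi> i \<omega>)) = distr (distr M borel (\<xi> i)) borel ?h"
      using distr_distr[OF h, of "\<xi> i" M] unfolding comp_def by metis
    also have "\<dots> = distr (distr M borel (\<xi> 1)) borel ?h"
      using i by (simp only: ident[of i] atLeastAtMost_iff)
    also have "\<dots> = distr M borel (\<lambda>\<omega>. ?h (\<xi> 1 \<omega>))"
      using distr_distr[OF h rv1] unfolding comp_def .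
    finally show "distr M borel (\<lambda>\<omega>. ?h (\<xi> i \<omega>)) = distr M borel (\<lambda>\<omega>. ?h (\<xi> 1 \<omega>))" .
  next
    show "(\<lambda>\<omega>. ?h (\<xi> 1 \<omega>)) \<in> borel_measurable M"
      using measurable_compose[OF rv1, of ?h borel] by simp
    show "AE \<omega> in M. ?h (\<xi> 1 \<omega>) \<in> {0..1}" by (simp add: indicator_def)
  qed simp_all
  have "expectation (\<lambda>\<omega>. ?h (\<xi> 1 \<omega>)) = expectation (indicator {\<omega> \<in> space M. \<xi> 1 \<omega> \<le> t})"
    by (intro Bochner_Integration.integral_cong) (auto simp: indicator_def)
  also have "\<dots> = prob {\<omega> \<in> space M. \<xi> 1 \<omega> \<le> t}"
    using rv1 by simp
  also have "\<dots> = F t" by (rule F[symmetric])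
  finally have E: "expectation (\<lambda>\<omega>. ?h (\<xi> 1 \<omega>)) = F t" .
  have "{1..n} \<noteq> {}" using \<open>n > 0\<close> by simp
  from H.Hoeffding_ineq_abs_ge'[OF \<open>\<delta> \<ge> 0\<close> zero_less_one this, unfolded E]
  show ?thesis
    unfolding ecdf_eq_sum_indicator card_atLeastAtMost diff_Suc_1 diff_zero power_one div_by_1 .
qed

lemma obtain_quantile_grids:
  assumes "a \<le> b"
  obtains q where "\<And>K. 0 < K \<Longrightarrow> fine_grid F a b K (q K)"
proof -
  have "\<exists>q. 0 < K \<longrightarrow> fine_grid F a b K q" for K
    using quantile_grid_exists[OF continuous_on_subset[OF cont] assms monoD[OF mono_F assms]]
      F_bounds(2)[of b] F_bounds(1)[of a] by auto
  then show ?thesis using that by metis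
qed

lemma Sup_deviation_event:
  assumes "a \<le> b" "0 \<le> c"
  shows "{\<omega> \<in> space M. (SUP t\<in>{a..b}. c * \<bar>ecdf \<xi> n \<omega> t - F t\<bar>) \<ge> \<epsilon>} \<in> events"
proof -
  obtain q where q: "\<And>K. 0 < K \<Longrightarrow> fine_grid F a b K (q K)"
    using obtain_quantile_grids[OF \<open>a \<le> b\<close>] by blast
  note [measurable] = ecdf_measurable
  have "{\<omega> \<in> space M. \<forall>K>0. \<exists>j\<le>K. \<epsilon> - c / real K \<le> c * \<bar>ecdf \<xi> n \<omega> (q K j) - F (q K j)\<bar>} \<in> events"
    by measurable
  then show ?thesis
    by (simp only: Sup_deviation_ge_iff[OF mono_F mono_ecdf assms q])
qed

text \<open>Union bound and Hoeffding's inequality over the \<open>n + 1\<close> points of a quantile grid of mesh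
  \<open>1/n\<close>. The mesh is what is subtracted from \<open>\<epsilon> / c\<close>; the last hypothesis keeps the remaining deviation
  nonnegative.\<close>

lemma prob_Sup_deviation_le:
  assumes "a \<le> b" "0 < c" "0 < n" "1 / real n \<le> \<epsilon> / c"
  shows "prob {\<omega> \<in> space M. (SUP t\<in>{a..b}. c * \<bar>ecdf \<xi> n \<omega> t - F t\<bar>) \<ge> \<epsilon>}
    \<le> 2 * real (n + 1) * exp (- 2 * real n * (\<epsilon> / c - 1 / real n)\<^sup>2)"
proof -
  obtain q where q: "\<And>K. 0 < K \<Longrightarrow> fine_grid F a b K (q K)"
    using obtain_quantile_grids[OF \<open>a \<le> b\<close>] by blast
  note [measurable] = ecdf_measurable
  define D where "D j = {\<omega> \<in> space M. \<epsilon> / c - 1 / real n \<le> \<bar>ecdf \<xi> n \<omega> (q n j) - F (q n j)\<bar>}" for j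
  have D: "D j \<in> events" for j unfolding D_def by measurable
  have scale: "\<epsilon> - c / real n \<le> c * x \<longleftrightarrow> \<epsilon> / c - 1 / real n \<le> x" for x
    using \<open>0 < c\<close> \<open>0 < n\<close> by (simp add: field_simps)
  have "prob {\<omega> \<in> space M. (SUP t\<in>{a..b}. c * \<bar>ecdf \<xi> n \<omega> t - F t\<bar>) \<ge> \<epsilon>} \<le> prob (\<Union>j\<le>n. D j)"
  proof (rule finite_measure_mono)
    show "(\<Union>j\<le>n. D j) \<in> events" using D by (intro sets.finite_UN) auto
    show "{\<omega> \<in> space M. (SUP t\<in>{a..b}. c * \<bar>ecdf \<xi> n \<omega> t - F t\<bar>) \<ge> \<epsilon>} \<subseteq> (\<Union>j\<le>n. D j)"
    proof
      fix \<omega> assume "\<omega> \<in> {\<omega> \<in> space M. (SUP t\<in>{a..b}. c * \<bar>ecdf \<xi> n \<omega> t - F t\<bar>) \<ge> \<epsilon>}"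
      then have "\<omega> \<in> space M" and *: "\<epsilon> \<le> (SUP t\<in>{a..b}. c * \<bar>ecdf \<xi> n \<omega> t - F t\<bar>)" by auto
      from * obtain j where "j \<le> n" "\<epsilon> - c / real n \<le> c * \<bar>ecdf \<xi> n \<omega> (q n j) - F (q n j)\<bar>"
        using Sup_deviation_ge_iff[OF mono_F mono_ecdf \<open>a \<le> b\<close> less_imp_le[OF \<open>0 < c\<close>] q, of \<epsilon> \<xi> n \<omega>]
          \<open>0 < n\<close> by auto
      with \<open>\<omega> \<in> space M\<close> show "\<omega> \<in> (\<Union>j\<le>n. D j)" by (auto simp: D_def scale)
    qed
  qed
  also have "\<dots> \<le> (\<Sum>j\<le>n. prob (D j))"
    using D by (intro finite_measure_subadditive_finite) auto
  also have "\<dots> \<le> (\<Sum>j\<le>n. 2 * exp (- 2 * real n * (\<epsilon> / c - 1 / real n)\<^sup>2))"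
    unfolding D_def using assms by (intro sum_mono ecdf_deviation_le) auto
  also have "\<dots> = 2 * real (n + 1) * exp (- 2 * real n * (\<epsilon> / c - 1 / real n)\<^sup>2)"
    by simp
  finally show ?thesis .
qed

text \<open>At a median \<open>m\<close> the empirical distribution function equals \<open>k / n\<close> exactly when \<open>k\<close> sample points
  do not exceed \<open>m\<close>. For a \<open>k\<close> that satisfies the last hypothesis this alone forces the deviation
  at \<open>m\<close>, hence the supremum, to reach \<open>\<epsilon>\<close>.\<close>

lemma prob_Sup_deviation_ge:
  assumes "a \<le> m" "m \<le> b" "F m = 1/2" "0 \<le> c" "0 < k" "k < n"
    and reach: "\<epsilon> \<le> c * (real k / real n - 1/2)"
  shows "exp (- real n * fair_coin_KL (real k / real n - 1/2)) / real (n + 1)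
    \<le> prob {\<omega> \<in> space M. (SUP t\<in>{a..b}. c * \<bar>ecdf \<xi> n \<omega> t - F t\<bar>) \<ge> \<epsilon>}"
proof -
  have "prob {\<omega> \<in> space M. card {i \<in> {1..n}. \<xi> i \<omega> \<in> {..m}} = k}
      = real (card {1..n} choose k) * (1/2) ^ k * (1 - 1/2) ^ (card {1..n} - k)"
  proof (rule prob_card_hits_eq_binomial)
    show "indep_vars (\<lambda>_. borel) \<xi> {1..n}" by (rule indep_vars_subset[OF indep]) auto
    show "prob (\<xi> i -` {..m} \<inter> space M) = 1/2" if "i \<in> {1..n}" for i
      using prob_sample_le[of i m] that assms by simp
  qed (use assms in auto)
  also have "\<dots> = real (n choose k) * ((1/2) ^ k * (1/2) ^ (n - k))" by simp
  also have "\<dots> = real (n choose k) / 2 ^ n"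
    using \<open>k < n\<close> by (simp add: power_add[symmetric] power_one_over)
  finally have "exp (- real n * fair_coin_KL (real k / real n - 1/2)) / real (n + 1)
      \<le> prob {\<omega> \<in> space M. card {i \<in> {1..n}. \<xi> i \<omega> \<in> {..m}} = k}"
    using binomial_fair_ge_exp_KL[OF assms(5,6)] by simp
  also have "\<dots> \<le> prob {\<omega> \<in> space M. (SUP t\<in>{a..b}. c * \<bar>ecdf \<xi> n \<omega> t - F t\<bar>) \<ge> \<epsilon>}"
  proof (rule finite_measure_mono)
    show "{\<omega> \<in> space M. (SUP t\<in>{a..b}. c * \<bar>ecdf \<xi> n \<omega> t - F t\<bar>) \<ge> \<epsilon>} \<in> events"
      using assms by (intro Sup_deviation_event) auto
    show "{\<omega> \<in> space M. card {i \<in> {1..n}. \<xi> i \<omega> \<in> {..m}} = k}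
        \<subseteq> {\<omega> \<in> space M. (SUP t\<in>{a..b}. c * \<bar>ecdf \<xi> n \<omega> t - F t\<bar>) \<ge> \<epsilon>}"
    proof (intro Collect_mono impI conjI; elim conjE)
      fix \<omega> assume "card {i \<in> {1..n}. \<xi> i \<omega> \<in> {..m}} = k"
      then have "ecdf \<xi> n \<omega> m = real k / real n" by (simp only: ecdf_eq_card)
      then have "c * (real k / real n - 1/2) \<le> c * \<bar>ecdf \<xi> n \<omega> m - F m\<bar>"
        using \<open>F m = 1/2\<close> \<open>0 \<le> c\<close> by (intro mult_left_mono) auto
      also have "\<dots> \<le> (SUP t\<in>{a..b}. c * \<bar>ecdf \<xi> n \<omega> t - F t\<bar>)"
        using assms by (intro cSUP_upper bdd_above_deviation mono_F mono_ecdf) auto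
      finally show "\<epsilon> \<le> (SUP t\<in>{a..b}. c * \<bar>ecdf \<xi> n \<omega> t - F t\<bar>)" using reach by linarith
    qed
  qed
  finally show ?thesis .
qed

end

section \<open>Limits of the two exponents\<close>

lemma upper_rate_limit:
  fixes \<alpha> \<epsilon> :: real
  assumes "0 < \<alpha>" "\<alpha> < 1/2" "0 < \<epsilon>"
  shows "(\<lambda>n. 1 / real n powr (1 - 2 * \<alpha>) *
      (ln (2 * real (n + 1)) - 2 * real n * (\<epsilon> / real n powr \<alpha> - 1 / real n)\<^sup>2)) \<longlonglongrightarrow> - 2 * \<epsilon>\<^sup>2"
  using assms by real_asymp

text \<open>The main term is \<open>(n powr \<alpha> * d n)\<^sup>2\<close> times \<open>fair_coin_KL (d n) / (d n)\<^sup>2\<close>. The first factor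
  tends to \<open>\<epsilon>\<^sup>2\<close>, the second to \<open>2\<close> because \<open>d n\<close> tends to \<open>0\<close> from the right.\<close>

lemma lower_rate_limit:
  fixes \<alpha> \<epsilon> :: real and d :: "nat \<Rightarrow> real"
  assumes "0 < \<alpha>" "\<alpha> < 1/2" "0 < \<epsilon>" and d: "(\<lambda>n. real n powr \<alpha> * d n) \<longlonglongrightarrow> \<epsilon>"
  shows "(\<lambda>n. 1 / real n powr (1 - 2 * \<alpha>) * (- real n * fair_coin_KL (d n) - ln (real (n + 1))))
    \<longlonglongrightarrow> - 2 * \<epsilon>\<^sup>2"
proof -
  have "(\<lambda>n. (real n powr \<alpha> * d n) * real n powr (- \<alpha>)) \<longlonglongrightarrow> \<epsilon> * 0"
    using \<open>0 < \<alpha>\<close> by (intro tendsto_mult d) real_asymp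
  moreover have "\<forall>\<^sub>F n in sequentially. (real n powr \<alpha> * d n) * real n powr (- \<alpha>) = d n"
    using eventually_gt_at_top[of 0] by eventually_elim (simp add: powr_minus field_simps)
  ultimately have "d \<longlonglongrightarrow> 0" by (simp add: tendsto_cong)
  moreover have pos: "\<forall>\<^sub>F n in sequentially. d n > 0"
    using order_tendstoD(1)[OF d \<open>0 < \<epsilon>\<close>] eventually_gt_at_top[of 0]
    by eventually_elim (simp add: zero_less_mult_iff)
  ultimately have "filterlim d (at_right 0) sequentially"
    by (simp add: filterlim_at eventually_mono)
  then have KL: "(\<lambda>n. fair_coin_KL (d n) / (d n)\<^sup>2) \<longlonglongrightarrow> 2"
    by (rule filterlim_compose[OF fair_coin_KL_asymp])
  have log: "(\<lambda>n. ln (real (n + 1)) / real n powr (1 - 2 * \<alpha>)) \<longlonglongrightarrow> 0"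
    using assms(1,2) by real_asymp
  have "(\<lambda>n. - ((real n powr \<alpha> * d n)\<^sup>2 * (fair_coin_KL (d n) / (d n)\<^sup>2))
      - ln (real (n + 1)) / real n powr (1 - 2 * \<alpha>)) \<longlonglongrightarrow> - (\<epsilon>\<^sup>2 * 2) - 0"
    by (intro tendsto_intros d KL log)
  moreover have "\<forall>\<^sub>F n in sequentially. - ((real n powr \<alpha> * d n)\<^sup>2 * (fair_coin_KL (d n) / (d n)\<^sup>2))
      - ln (real (n + 1)) / real n powr (1 - 2 * \<alpha>)
    = 1 / real n powr (1 - 2 * \<alpha>) * (- real n * fair_coin_KL (d n) - ln (real (n + 1)))"
    using pos eventually_gt_at_top[of 0]
  proof eventually_elim
    case (elim n)
    have "(real n powr \<alpha>)\<^sup>2 = real n / real n powr (1 - 2 * \<alpha>)"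
      using elim by (simp add: powr_diff power2_eq_square flip: powr_add)
    then show ?case using elim by (simp add: power_mult_distrib diff_divide_distrib)
  qed
  ultimately show ?thesis by (simp add: tendsto_cong mult.commute)
qed

text \<open>The number \<open>k n\<close> is the least count of successes whose frequency exceeds \<open>1/2\<close> by
  \<open>\<epsilon> n powr (-\<alpha>)\<close> or more. Rounding up guarantees that the deviation reaches \<open>\<epsilon>\<close>, and the rounding
  error is at most \<open>n powr (\<alpha> - 1)\<close> after rescaling, so it vanishes in the limit.\<close>

lemma tilted_count_bounds:
  fixes \<alpha> \<epsilon> :: real
  assumes "0 < \<alpha>" "0 < \<epsilon>" "\<alpha> < 1"
  defines "k \<equiv> \<lambda>n::nat. nat \<lceil>real n / 2 + \<epsilon> * real n powr (1 - \<alpha>)\<rceil>"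
  shows "\<forall>\<^sub>F n in sequentially. 0 < k n \<and> k n < n"
    and "\<forall>\<^sub>F n in sequentially. \<epsilon> \<le> real n powr \<alpha> * (real (k n) / real n - 1/2)"
    and "(\<lambda>n. real n powr \<alpha> * (real (k n) / real n - 1/2)) \<longlonglongrightarrow> \<epsilon>"
proof -
  have k: "real n / 2 + \<epsilon> * real n powr (1 - \<alpha>) \<le> real (k n)"
    "real (k n) \<le> real n / 2 + \<epsilon> * real n powr (1 - \<alpha>) + 1" for n
  proof -
    have "0 \<le> real n / 2 + \<epsilon> * real n powr (1 - \<alpha>)" using \<open>0 < \<epsilon>\<close> by simp
    then have "real (k n) = of_int \<lceil>real n / 2 + \<epsilon> * real n powr (1 - \<alpha>)\<rceil>"
      unfolding k_def by (subst of_nat_nat) linarith+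
    then show "real n / 2 + \<epsilon> * real n powr (1 - \<alpha>) \<le> real (k n)"
      "real (k n) \<le> real n / 2 + \<epsilon> * real n powr (1 - \<alpha>) + 1"
      by linarith+
  qed
  have "\<forall>\<^sub>F n in sequentially. real n / 2 + \<epsilon> * real n powr (1 - \<alpha>) + 1 < real n"
    using assms(1,2) by real_asymp
  then show "\<forall>\<^sub>F n in sequentially. 0 < k n \<and> k n < n"
    using eventually_gt_at_top[of 0]
  proof eventually_elim
    case (elim n)
    have "0 < real n / 2 + \<epsilon> * real n powr (1 - \<alpha>)" using elim \<open>0 < \<epsilon>\<close> by (simp add: add_pos_nonneg)
    then show ?case using k[of n] elim by linarith
  qed
  have lo: "\<epsilon> \<le> real n powr \<alpha> * (real (k n) / real n - 1/2)"
    and up: "real n powr \<alpha> * (real (k n) / real n - 1/2) \<le> \<epsilon> + real n powr (\<alpha> - 1)"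
    if "0 < n" for n
  proof -
    have e: "real n powr \<alpha> * (\<epsilon> * real n powr (1 - \<alpha>) / real n) = \<epsilon>"
      using that by (simp add: powr_diff)
    have "\<epsilon> * real n powr (1 - \<alpha>) / real n \<le> real (k n) / real n - 1/2"
      using divide_right_mono[OF k(1)[of n], of "real n"] that by (simp add: add_divide_distrib)
    from mult_left_mono[OF this, of "real n powr \<alpha>"]
    show "\<epsilon> \<le> real n powr \<alpha> * (real (k n) / real n - 1/2)" unfolding e by simp
    have "real (k n) / real n - 1/2 \<le> \<epsilon> * real n powr (1 - \<alpha>) / real n + 1 / real n"
      using divide_right_mono[OF k(2)[of n], of "real n"] that by (simp add: add_divide_distrib)
    from mult_left_mono[OF this, of "real n powr \<alpha>"]
    show "real n powr \<alpha> * (real (k n) / real n - 1/2) \<le> \<epsilon> + real n powr (\<alpha> - 1)"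
      unfolding distrib_left e using that by (simp add: powr_diff)
  qed
  show "\<forall>\<^sub>F n in sequentially. \<epsilon> \<le> real n powr \<alpha> * (real (k n) / real n - 1/2)"
    using eventually_gt_at_top[of 0] by eventually_elim (rule lo)
  show "(\<lambda>n. real n powr \<alpha> * (real (k n) / real n - 1/2)) \<longlonglongrightarrow> \<epsilon>"
  proof (rule tendsto_sandwich)
    show "\<forall>\<^sub>F n in sequentially. \<epsilon> \<le> real n powr \<alpha> * (real (k n) / real n - 1/2)"
      using eventually_gt_at_top[of 0] by eventually_elim (rule lo)
    show "\<forall>\<^sub>F n in sequentially.
        real n powr \<alpha> * (real (k n) / real n - 1/2) \<le> \<epsilon> + real n powr (\<alpha> - 1)"
      using eventually_gt_at_top[of 0] by eventually_elim (rule up)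
    show "(\<lambda>n. \<epsilon> + real n powr (\<alpha> - 1)) \<longlonglongrightarrow> \<epsilon>" using \<open>\<alpha> < 1\<close> by real_asymp
  qed simp
qed

section \<open>The moderate deviation limit\<close>

theorem theorem4p1:
  fixes M :: "'a measure" and \<xi> :: "nat \<Rightarrow> 'a \<Rightarrow> real" and F :: "real \<Rightarrow> real"
  assumes "prob_space M"
    and indep: "prob_space.indep_vars M (\<lambda>_. borel) \<xi> {1..}"
    and ident: "\<And>k. k \<ge> 1 \<Longrightarrow> distr M borel (\<xi> k) = distr M borel (\<xi> 1)"
    and range: "\<And>k \<omega>. k \<ge> 1 \<Longrightarrow> \<omega> \<in> space M \<Longrightarrow> \<xi> k \<omega> \<in> {0..1}"
    and F: "\<And>t. F t = measure M {\<omega> \<in> space M. \<xi> 1 \<omega> \<le> t}"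
    and cont: "continuous_on UNIV F"
  shows "\<exists>T0\<in>{0<..<1}. \<forall>T\<in>{T0<..<1}. \<forall>\<alpha>\<in>{0<..<1/2}. \<forall>\<epsilon>>0.
    (\<lambda>n. 1 / real n powr (1 - 2 * \<alpha>) *
        ln (measure M {\<omega> \<in> space M.
              (SUP t\<in>{0..T}. real n powr \<alpha> * \<bar>ecdf \<xi> n \<omega> t - F t\<bar>) \<ge> \<epsilon>}))
      \<longlonglongrightarrow> - 2 * \<epsilon>\<^sup>2"
proof -
  interpret continuous_iid_sample M \<xi> F
    by (intro continuous_iid_sample.intro continuous_iid_sample_axioms.intro assms)
  have neg: "F t = 0" if "t < 0" for t
  proof -
    have "{\<omega> \<in> space M. \<xi> 1 \<omega> \<le> t} = {}" using range[of 1] that by force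
    then show ?thesis by (simp only: F measure_empty)
  qed
  have one: "F 1 = 1"
  proof -
    have "{\<omega> \<in> space M. \<xi> 1 \<omega> \<le> 1} = space M" using range[of 1] by force
    then show ?thesis by (simp only: F prob_space)
  qed
  \<comment> \<open>Starting the intermediate value argument at \<open>-1\<close> avoids the value of \<open>F\<close> at \<open>0\<close>.\<close>
  obtain m where m: "m \<le> 1" "F m = 1/2"
    using IVT'[of F "-1" "1/2" 1] neg[of "-1"] one continuous_on_subset[OF cont] by auto
  have "0 \<le> m" using neg[of m] m by force
  have "m \<noteq> 1" using m one by auto
  with m have "m < 1" by simp
  show ?thesis
  proof (intro bexI[of _ "(m + 1) / 2"] ballI allI impI)
    show "(m + 1) / 2 \<in> {0<..<1}" using \<open>0 \<le> m\<close> \<open>m < 1\<close> by simp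
    fix T \<alpha> \<epsilon> :: real
    assume "T \<in> {(m + 1) / 2<..<1}" and "\<alpha> \<in> {0<..<1/2}" and "0 < \<epsilon>"
    then have "m \<le> T" and \<alpha>: "0 < \<alpha>" "\<alpha> < 1/2" "\<alpha> < 1" using \<open>m < 1\<close> by auto
    then have "0 \<le> T" using \<open>0 \<le> m\<close> by simp
    define P where "P n = prob {\<omega> \<in> space M.
      (SUP t\<in>{0..T}. real n powr \<alpha> * \<bar>ecdf \<xi> n \<omega> t - F t\<bar>) \<ge> \<epsilon>}" for n
    define d where "d n = real (nat \<lceil>real n / 2 + \<epsilon> * real n powr (1 - \<alpha>)\<rceil>) / real n - 1/2" for n
    note tilt = tilted_count_bounds[OF \<alpha>(1) \<open>0 < \<epsilon>\<close> \<alpha>(3)]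
    have fine: "\<forall>\<^sub>F n in sequentially. 1 / real n \<le> \<epsilon> / real n powr \<alpha>"
      using \<alpha> \<open>0 < \<epsilon>\<close> by real_asymp
    have lower: "\<forall>\<^sub>F n in sequentially. exp (- real n * fair_coin_KL (d n)) / real (n + 1) \<le> P n"
      using tilt(1,2)
    proof eventually_elim
      case (elim n)
      then show ?case
        unfolding P_def d_def using \<open>0 \<le> m\<close> \<open>m \<le> T\<close> m by (intro prob_Sup_deviation_ge) auto
    qed
    have upper: "\<forall>\<^sub>F n in sequentially. P n \<le>
        2 * real (n + 1) * exp (- 2 * real n * (\<epsilon> / real n powr \<alpha> - 1 / real n)\<^sup>2)"
      using fine eventually_gt_at_top[of 0]
    proof eventually_elim
      case (elim n)
      then show ?case unfolding P_def using \<open>0 \<le> T\<close> by (intro prob_Sup_deviation_le) auto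
    qed
    have "(\<lambda>n. 1 / real n powr (1 - 2 * \<alpha>) * ln (P n)) \<longlonglongrightarrow> - 2 * \<epsilon>\<^sup>2"
    proof (rule tendsto_sandwich)
      show "(\<lambda>n. 1 / real n powr (1 - 2 * \<alpha>) * (- real n * fair_coin_KL (d n) - ln (real (n + 1))))
          \<longlonglongrightarrow> - 2 * \<epsilon>\<^sup>2"
        using tilt(3) unfolding d_def[symmetric]
        by (intro lower_rate_limit \<alpha>(1,2) \<open>0 < \<epsilon>\<close>)
      show "(\<lambda>n. 1 / real n powr (1 - 2 * \<alpha>) *
          (ln (2 * real (n + 1)) - 2 * real n * (\<epsilon> / real n powr \<alpha> - 1 / real n)\<^sup>2))
          \<longlonglongrightarrow> - 2 * \<epsilon>\<^sup>2"
        by (rule upper_rate_limit[OF \<alpha>(1,2) \<open>0 < \<epsilon>\<close>])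
      show "\<forall>\<^sub>F n in sequentially.
          1 / real n powr (1 - 2 * \<alpha>) * (- real n * fair_coin_KL (d n) - ln (real (n + 1)))
          \<le> 1 / real n powr (1 - 2 * \<alpha>) * ln (P n)"
        using lower
      proof eventually_elim
        case (elim n)
        have "0 < exp (- real n * fair_coin_KL (d n)) / real (n + 1)" by simp
        from ln_mono[OF elim this]
        have "ln (exp (- real n * fair_coin_KL (d n)) / real (n + 1)) \<le> ln (P n)" .
        moreover have "ln (exp (- real n * fair_coin_KL (d n)) / real (n + 1))
            = - real n * fair_coin_KL (d n) - ln (real (n + 1))"
          by (subst ln_div) auto
        ultimately show ?case by (intro mult_left_mono) auto
      qed
      show "\<forall>\<^sub>F n in sequentially. 1 / real n powr (1 - 2 * \<alpha>) * ln (P n)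
          \<le> 1 / real n powr (1 - 2 * \<alpha>) *
            (ln (2 * real (n + 1)) - 2 * real n * (\<epsilon> / real n powr \<alpha> - 1 / real n)\<^sup>2)"
        \<comment> \<open>The lower bound enters because \<open>ln 0 = 0\<close>: the probability has to be known to be positive.\<close>
        using lower upper
      proof eventually_elim
        case (elim n)
        have "0 < exp (- real n * fair_coin_KL (d n)) / real (n + 1)" by simp
        with elim have "0 < P n" by linarith
        let ?e = "- 2 * real n * (\<epsilon> / real n powr \<alpha> - 1 / real n)\<^sup>2"
        have "ln (P n) \<le> ln (2 * real (n + 1) * exp ?e)"
          using \<open>0 < P n\<close> elim by (subst ln_le_cancel_iff) auto
        also have "\<dots> = ln (2 * real (n + 1)) + ?e" by (subst ln_mult) auto
        finally show ?case by (intro mult_left_mono) auto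
      qed
    qed
    then show "(\<lambda>n. 1 / real n powr (1 - 2 * \<alpha>) *
        ln (prob {\<omega> \<in> space M.
              (SUP t\<in>{0..T}. real n powr \<alpha> * \<bar>ecdf \<xi> n \<omega> t - F t\<bar>) \<ge> \<epsilon>}))
      \<longlonglongrightarrow> - 2 * \<epsilon>\<^sup>2" unfolding P_def .
  qed
qed

end
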